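(* Let $a\ge 1$, $n\ge 1$, $b\ge 3$ be integers and let $G_{a,b,n}=\overline{K}_a\nabla(nB_b)$. For $0\le k\le 2n$, the number of independent sets of size $k$ in $nB_b$ is $$s_k(nB_b)=\sum_{q=0}^{\lfloor k/2\rfloor}\binom{n}{q}\binom{n-q}{k-2q}(2b)^{k-2q}\big(b(b-1)\big)^q.$$ For $k\ge 1$, the number of independent sets of size $k$ in $G_{a,b,n}$ is $$s_k(G_{a,b,n})=\binom{a}{k}+s_k(nB_b),$$ and $s_0(G_{a,b,n})=1$.
   Context: All graphs are finite, simple and undirected. For $b\ge 2$, $B_b$ is the graph with vertices $x_1,\dots,x_b,y_1,\dots,y_b$ and edges $\{x_i,x_j\}$ and $\{y_i,y_j\}$ for $1\le i<j\le b$, and $\{x_i,y_i\}$ for $1\le i\le b$. $nB_b$ is the disjoint union of $n$ copies of $B_b$. The join $G\nabla H$ of graphs on disjoint vertex sets is obtained from the disjoint union by adding every edge between $V(G)$ and $V(H)$. $\overline{K}_a$ is the edgeless graph on $a$ vertices. $s_k(G)$ denotes the number of independent sets of size $k$ in $G$. Convention: $\binom{u}{v}=0$ if $v<0$ or $v>u$. *)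

theory Defs
  imports Complex_Main
begin

record 'a graph =
  verts :: "'a set"
  edges :: "'a set set"

definition simple_graph :: "'a graph \<Rightarrow> bool" where
  "simple_graph G \<longleftrightarrow> finite (verts G) \<and> (\<forall>e\<in>edges G. e \<subseteq> verts G \<and> card e = 2)"

definition independent :: "'a graph \<Rightarrow> 'a set \<Rightarrow> bool" where
  "independent G S \<longleftrightarrow> S \<subseteq> verts G \<and> (\<forall>u\<in>S. \<forall>v\<in>S. {u, v} \<notin> edges G)"

definition num_indep :: "nat \<Rightarrow> 'a graph \<Rightarrow> nat" where
  "num_indep k G = card {S. independent G S \<and> card S = k}"

definition edgeless :: "nat \<Rightarrow> nat graph" where
  "edgeless a = \<lparr>verts = {1..a}, edges = {}\<rparr>"

datatype bvert = X nat | Y nat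

definition B :: "nat \<Rightarrow> bvert graph" where
  "B b = \<lparr>verts = {X i | i. i \<in> {1..b}} \<union> {Y i | i. i \<in> {1..b}},
          edges = {{X i, X j} | i j. 1 \<le> i \<and> i < j \<and> j \<le> b}
                \<union> {{Y i, Y j} | i j. 1 \<le> i \<and> i < j \<and> j \<le> b}
                \<union> {{X i, Y i} | i. 1 \<le> i \<and> i \<le> b}\<rparr>"

text \<open>The disjoint union of \<open>n\<close> copies of \<open>G\<close>; the first component of a vertex says which copy
  it belongs to.\<close>

definition copies :: "nat \<Rightarrow> 'a graph \<Rightarrow> (nat \<times> 'a) graph" where
  "copies n G = \<lparr>verts = {1..n} \<times> verts G,
                 edges = {Pair i ` e | i e. i \<in> {1..n} \<and> e \<in> edges G}\<rparr>"

text \<open>The sum type makes the two vertex sets disjoint.\<close>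

definition join :: "'a graph \<Rightarrow> 'b graph \<Rightarrow> ('a + 'b) graph"  (infixl "\<nabla>" 65) where
  "G \<nabla> H = \<lparr>verts = Inl ` verts G \<union> Inr ` verts H,
             edges = {Inl ` e | e. e \<in> edges G} \<union> {Inr ` e | e. e \<in> edges H}
                   \<union> {{Inl u, Inr v} | u v. u \<in> verts G \<and> v \<in> verts H}\<rparr>"

definition G_abn :: "nat \<Rightarrow> nat \<Rightarrow> nat \<Rightarrow> (nat + nat \<times> bvert) graph" where
  "G_abn a b n = edgeless a \<nabla> copies n (B b)"

lemma simple_graph_edgeless: "simple_graph (edgeless a)"
  by (simp add: simple_graph_def edgeless_def)

lemma simple_graph_B: "simple_graph (B b)"
  by (auto simp: simple_graph_def B_def)

lemma simple_graph_copies: "simple_graph G \<Longrightarrow> simple_graph (copies n G)"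
  by (auto simp: simple_graph_def copies_def card_image inj_on_def)

lemma simple_graph_join: "simple_graph G \<Longrightarrow> simple_graph H \<Longrightarrow> simple_graph (G \<nabla> H)"
  by (auto simp: simple_graph_def join_def card_image; blast)

lemma simple_graph_G_abn: "simple_graph (G_abn a b n)"
  by (simp add: G_abn_def simple_graph_edgeless simple_graph_B simple_graph_copies
      simple_graph_join)

end

theory Submission
  imports Defs "HOL-Library.FuncSet" "HOL-Computational_Algebra.Polynomial"
begin

text \<open>Count with the independence polynomial, which is multiplicative over disjoint unions. For
  \<open>B b\<close> it is \<open>1 + 2b x + b(b - 1) x\<^sup>2\<close>, since an independent set contains at most one vertex
  of each of the two cliques; expanding the \<open>n\<close>-th power as \<open>((1 + 2b x) + b(b - 1) x\<^sup>2)\<^sup>n\<close>, twice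
  by the binomial theorem, gives the sum over \<open>q\<close>. In a join no independent set meets both sides,
  so the two families of nonempty independent sets are disjoint and exhaust all.\<close>

section \<open>The independence polynomial and its coefficients\<close>

definition indep_poly :: "'a graph \<Rightarrow> nat poly" where
  "indep_poly G = (\<Sum>S | independent G S. monom 1 (card S))"

lemma finite_independent: "finite (verts G) \<Longrightarrow> finite {S. independent G S}"
  by (rule finite_subset[of _ "Pow (verts G)"]) (auto simp: independent_def)

text \<open>Each independent set \<open>S\<close> adds 1 to the coefficient at \<open>card S\<close>
  and nothing to any other. Finiteness makes the defining sum a genuine one.\<close>

lemma coeff_indep_poly:
  assumes "finite (verts G)"
  shows "coeff (indep_poly G) k = num_indep k G"
proof -
  have "coeff (indep_poly G) k = (\<Sum>S | independent G S. if card S = k then 1 else 0)"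
    by (simp add: indep_poly_def coeff_sum cong: if_cong)
  also have "\<dots> = card ({S. independent G S} \<inter> {S. card S = k})"
    using finite_independent[OF assms] by (simp add: sum.If_cases)
  also have "{S. independent G S} \<inter> {S. card S = k} = {S. independent G S \<and> card S = k}"
    by blast
  finally show ?thesis
    by (simp add: num_indep_def)
qed

lemma num_indep_0:
  assumes "finite (verts G)"
  shows "num_indep 0 G = 1"
proof -
  \<comment> \<open>Infinite sets also have \<open>card\<close> 0; finiteness of the vertex set
    rules them out.\<close>
  have "{S. independent G S \<and> card S = 0} = {{}}"
    using assms by (auto simp: independent_def dest: finite_subset)
  then show ?thesis
    by (simp add: num_indep_def)
qed

section \<open>Disjoint unions and powers of the polynomial\<close>

lemma independent_copies_iff:
  "independent (copies n G) S \<longleftrightarrow>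
     S \<subseteq> {1..n} \<times> verts G \<and> (\<forall>i\<in>{1..n}. independent G (Pair i -` S))"
proof -
  have edge: "{(i, u), (j, v)} \<in> edges (copies n G) \<longleftrightarrow>
      i = j \<and> i \<in> {1..n} \<and> {u, v} \<in> edges G" for i j u v
  proof
    assume "{(i, u), (j, v)} \<in> edges (copies n G)"
    then obtain l e where l: "l \<in> {1..n}" "e \<in> edges G" "{(i, u), (j, v)} = Pair l ` e"
      by (auto simp: copies_def)
    then have "i = l" "j = l"
      by auto
    \<comment> \<open>Both endpoints lie in copy \<open>l\<close>, and cancelling the injective
      \<open>Pair l\<close> recovers the original edge.\<close>
    then have "Pair l ` {u, v} = Pair l ` e"
      using l by simp
    then have "e = {u, v}"
      by (subst (asm) inj_image_eq_iff) (auto simp: inj_on_def)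
    then show "i = j \<and> i \<in> {1..n} \<and> {u, v} \<in> edges G"
      using l \<open>i = l\<close> \<open>j = l\<close> by simp
  next
    assume *: "i = j \<and> i \<in> {1..n} \<and> {u, v} \<in> edges G"
    moreover have "{(j, u), (j, v)} = Pair j ` {u, v}"
      by simp
    ultimately show "{(i, u), (j, v)} \<in> edges (copies n G)"
      unfolding copies_def by (simp del: image_insert) blast
  qed
  have "verts (copies n G) = {1..n} \<times> verts G"
    by (simp add: copies_def)
  then have "independent (copies n G) S \<longleftrightarrow> S \<subseteq> {1..n} \<times> verts G \<and>
      (\<forall>i\<in>{1..n}. \<forall>u v. (i, u) \<in> S \<longrightarrow> (i, v) \<in> S \<longrightarrow> {u, v} \<notin> edges G)"
    unfolding independent_def by (simp add: Ball_def edge) blast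
  then show ?thesis
    by (auto simp: independent_def)
qed

text \<open>This splits off the last copy, as the induction on \<open>n\<close> requires. The
  inverse map keeps the part in the first \<open>n\<close> copies and takes the slice in copy
  \<open>Suc n\<close>.\<close>

lemma bij_betw_independent_copies_Suc:
  "bij_betw (\<lambda>(S, T). S \<union> Pair (Suc n) ` T)
     ({S. independent (copies n G) S} \<times> {T. independent G T})
     {S. independent (copies (Suc n) G) S}"
proof (rule bij_betwI[where g = "\<lambda>S. (S \<inter> {1..n} \<times> UNIV, Pair (Suc n) -` S)"])
  show "(\<lambda>(S, T). S \<union> Pair (Suc n) ` T)
      \<in> {S. independent (copies n G) S} \<times> {T. independent G T}
        \<rightarrow> {S. independent (copies (Suc n) G) S}"
  proof (clarsimp simp: independent_copies_iff)
    fix S T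
    assume S: "S \<subseteq> {Suc 0..n} \<times> verts G" "\<forall>i\<in>{Suc 0..n}. independent G (Pair i -` S)"
      and T: "independent G T"
    have "T \<subseteq> verts G"
      using T by (simp add: independent_def)
    moreover have "independent G (Pair i -` S \<union> Pair i -` Pair (Suc n) ` T)"
      if "i \<in> {Suc 0..Suc n}" for i
    proof (cases "i = Suc n")
      case True
      then have "Pair i -` S \<union> Pair i -` Pair (Suc n) ` T = T"
        using S(1) by auto
      then show ?thesis
        using T by simp
    next
      case False
      then have "Pair i -` S \<union> Pair i -` Pair (Suc n) ` T = Pair i -` S"
        by auto
      then show ?thesis
        using S(2) False that by simp
    qed
    ultimately show "S \<subseteq> {Suc 0..Suc n} \<times> verts G \<and> Pair (Suc n) ` T \<subseteq> {Suc 0..Suc n} \<times> verts G \<and>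
        (\<forall>i\<in>{Suc 0..Suc n}. independent G (Pair i -` S \<union> Pair i -` Pair (Suc n) ` T))"
      using S(1) by auto
  qed
  show "(\<lambda>S. (S \<inter> {1..n} \<times> UNIV, Pair (Suc n) -` S))
      \<in> {S. independent (copies (Suc n) G) S}
        \<rightarrow> {S. independent (copies n G) S} \<times> {T. independent G T}"
  proof (clarsimp simp: independent_copies_iff)
    fix S
    assume S: "S \<subseteq> {Suc 0..Suc n} \<times> verts G" "\<forall>i\<in>{Suc 0..Suc n}. independent G (Pair i -` S)"
    have "Pair i -` S \<inter> Pair i -` ({Suc 0..n} \<times> UNIV) = Pair i -` S" if "i \<in> {Suc 0..n}" for i
      using that by auto
    then show "S \<inter> {Suc 0..n} \<times> UNIV \<subseteq> {Suc 0..n} \<times> verts G \<and>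
        (\<forall>i\<in>{Suc 0..n}. independent G (Pair i -` S \<inter> Pair i -` ({Suc 0..n} \<times> UNIV)))"
      using S by auto
  qed
\<comment> \<open>The two inverse laws remain; \<open>le_Suc_eq\<close> separates the new copy from
  the old ones.\<close>
qed (auto simp: independent_copies_iff, (force simp: le_Suc_eq)+)

lemma indep_poly_copies:
  assumes "finite (verts G)"
  shows "indep_poly (copies n G) = indep_poly G ^ n"
proof (induction n)
  case 0
  have "{S. independent (copies 0 G) S} = {{}}"
    by (auto simp: independent_copies_iff)
  then show ?case
    by (simp add: indep_poly_def one_pCons monom_0)
next
  case (Suc n)
  \<comment> \<open>Sizes add because \<open>S\<close> avoids copy \<open>Suc n\<close>; this turns
    each monomial of the sum into a product of two.\<close>
  have card_Un: "card (S \<union> Pair (Suc n) ` T) = card S + card T"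
    if "independent (copies n G) S" "independent G T" for S T
  proof -
    have S: "S \<subseteq> {1..n} \<times> verts G"
      using that by (simp add: independent_copies_iff)
    have "finite T"
      using that assms by (auto simp: independent_def dest: finite_subset)
    moreover have "finite S"
      using finite_subset[OF S] assms by simp
    moreover have "S \<inter> Pair (Suc n) ` T = {}"
      using S by auto
    ultimately show ?thesis
      by (simp add: card_Un_disjoint card_image inj_on_def)
  qed
  have "indep_poly (copies (Suc n) G) =
      (\<Sum>(S, T) \<in> {S. independent (copies n G) S} \<times> {T. independent G T}.
        monom 1 (card (S \<union> Pair (Suc n) ` T)))"
    unfolding indep_poly_def
    by (subst sum.reindex_bij_betw[OF bij_betw_independent_copies_Suc, symmetric])
      (simp add: case_prod_unfold)
  also have "\<dots> = (\<Sum>(S, T) \<in> {S. independent (copies n G) S} \<times> {T. independent G T}.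
        monom 1 (card S) * monom 1 (card T))"
    by (rule sum.cong) (auto simp: card_Un mult_monom)
  also have "\<dots> = indep_poly (copies n G) * indep_poly G"
    by (simp add: indep_poly_def sum_product sum.cartesian_product)
  finally show ?case
    by (simp add: Suc mult.commute)
qed

section \<open>Independent sets of \<open>B b\<close>\<close>

text \<open>The three families have sizes 0, 1 and 2. A set of size 2 must take one vertex from each
  clique, and the matching edges force \<open>i \<noteq> j\<close>.\<close>

lemma independent_B:
  "{S. independent (B b) S} =
     {{}} \<union> (\<lambda>v. {v}) ` verts (B b)
     \<union> (\<lambda>(i, j). {X i, Y j}) ` (SIGMA i:{1..b}. {1..b} - {i})" (is "?L = ?R")
proof
  \<comment> \<open>The definition lists clique edges with the smaller index first, hence the case
    split on the order of \<open>i\<close> and \<open>j\<close>.\<close>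
  have edge_XX: "{X i, X j} \<in> edges (B b) \<longleftrightarrow> i \<noteq> j \<and> i \<in> {1..b} \<and> j \<in> {1..b}"
    and edge_YY: "{Y i, Y j} \<in> edges (B b) \<longleftrightarrow> i \<noteq> j \<and> i \<in> {1..b} \<and> j \<in> {1..b}"
    and edge_XY: "{X i, Y j} \<in> edges (B b) \<longleftrightarrow> i = j \<and> i \<in> {1..b}"
    for i j
    by (cases i j rule: linorder_cases; force simp: B_def doubleton_eq_iff)+
  \<comment> \<open>The definition of \<open>independent\<close> also tests \<open>u = v\<close>, so
    singletons are independent only because no edge has size 1.\<close>
  have no_loop: "{v} \<notin> edges (B b)" for v
    using simple_graph_B[of b] by (fastforce simp: simple_graph_def)
  have verts_B: "verts (B b) = X ` {1..b} \<union> Y ` {1..b}"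
    by (auto simp: B_def)
  show "?L \<subseteq> ?R"
  proof
    fix S assume "S \<in> ?L"
    then have sub: "S \<subseteq> X ` {1..b} \<union> Y ` {1..b}"
      and ind: "\<And>u v. u \<in> S \<Longrightarrow> v \<in> S \<Longrightarrow> {u, v} \<notin> edges (B b)"
      by (auto simp: independent_def verts_B)
    have X_eq: "i = j" if "X i \<in> S" "X j \<in> S" for i j
      using ind[OF that] sub that by (auto simp: edge_XX)
    have Y_eq: "i = j" if "Y i \<in> S" "Y j \<in> S" for i j
      using ind[OF that] sub that by (auto simp: edge_YY)
    have XY_neq: "i \<noteq> j" if "X i \<in> S" "Y j \<in> S" for i j
      using ind[OF that] sub that by (auto simp: edge_XY)
    show "S \<in> ?R"
    proof (cases "\<exists>i. X i \<in> S")
      case True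
      then obtain i where i: "X i \<in> S" ..
      show ?thesis
      proof (cases "\<exists>j. Y j \<in> S")
        case True
        then obtain j where j: "Y j \<in> S" ..
        have "S = {X i, Y j}"
          using i j sub X_eq Y_eq by blast
        moreover have "(i, j) \<in> (SIGMA i:{1..b}. {1..b} - {i})"
          using i j sub XY_neq by auto
        ultimately show ?thesis
          by force
      next
        case False
        then have "S = {X i}"
          using i sub X_eq by blast
        then show ?thesis
          using sub by (auto simp: verts_B)
      qed
    next
      case noX: False
      show ?thesis
      proof (cases "\<exists>j. Y j \<in> S")
        case True
        then obtain j where "Y j \<in> S" ..
        then have "S = {Y j}"
          using noX sub Y_eq by blast
        then show ?thesis
          using sub by (auto simp: verts_B)
      next
        case False
        then have "S = {}"
          using noX sub by blast
        then show ?thesis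
          by simp
      qed
    qed
  qed
  show "?R \<subseteq> ?L"
    by (auto simp: independent_def verts_B no_loop edge_XY insert_commute[of "Y _" "X _"])
qed

lemma card_verts_B: "card (verts (B b)) = 2 * b"
proof -
  have "verts (B b) = X ` {1..b} \<union> Y ` {1..b}"
    by (auto simp: B_def)
  moreover have "card (X ` {1..b} \<union> Y ` {1..b}) = card (X ` {1..b}) + card (Y ` {1..b})"
    by (rule card_Un_disjoint) auto
  ultimately show ?thesis
    by (simp add: card_image inj_on_def)
qed

lemma finite_verts_B: "finite (verts (B b))"
  using simple_graph_B by (simp add: simple_graph_def)

lemma indep_poly_B: "indep_poly (B b) = 1 + monom (2 * b) 1 + monom (b * (b - 1)) 2"
proof -
  let ?P = "SIGMA i:{1..b}. {1..b} - {i}"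
  let ?p = "\<lambda>(i, j). {X i, Y j}"
  have card_P: "card ?P = b * (b - 1)"
    by (simp add: card_SigmaI)
  \<comment> \<open>The constructors tell the two entries apart, so the set determines the ordered
    pair and no factor 1/2 appears.\<close>
  have inj: "inj_on ?p ?P"
    by (auto simp: inj_on_def doubleton_eq_iff)
  \<comment> \<open>The index type is generic because the fact serves both vertices and index
    pairs.\<close>
  have sum_monom: "(\<Sum>x\<in>A. monom 1 k) = monom (card A) k" for A :: "'c set" and k
    by (simp add: of_nat_poly smult_monom)
  have "indep_poly (B b) = monom 1 (card ({} :: bvert set))
      + (\<Sum>S \<in> (\<lambda>v. {v}) ` verts (B b). monom 1 (card S)) + (\<Sum>S \<in> ?p ` ?P. monom 1 (card S))"
    unfolding indep_poly_def independent_B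
    by (subst sum.union_disjoint, (force simp: finite_verts_B)+)+
  also have "(\<Sum>S \<in> (\<lambda>v. {v}) ` verts (B b). monom 1 (card S)) = (\<Sum>v \<in> verts (B b). monom 1 1)"
    by (simp add: sum.reindex)
  also have "\<dots> = monom (2 * b) 1"
    by (simp only: sum_monom card_verts_B)
  also have "(\<Sum>S \<in> ?p ` ?P. monom 1 (card S)) = (\<Sum>x \<in> ?P. monom 1 2)"
    by (subst sum.reindex[OF inj]) (auto intro!: sum.cong simp: numeral_2_eq_2)
  also have "\<dots> = monom (b * (b - 1)) 2"
    by (simp only: sum_monom card_P)
  finally show ?thesis
    by (simp add: one_pCons monom_0)
qed

section \<open>Powers of a quadratic polynomial\<close>

text \<open>Here \<open>q\<close> counts the factors contributing their quadratic term;
  \<open>k - 2 * q\<close> of the other \<open>n - q\<close> must then contribute the linear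
  one.\<close>

lemma coeff_quadratic_power:
  fixes c d :: "'a :: comm_semiring_1"
  shows "coeff ((1 + monom c 1 + monom d 2) ^ n) k =
    (\<Sum>q = 0..k div 2. of_nat (n choose q) * of_nat ((n - q) choose (k - 2 * q))
       * c ^ (k - 2 * q) * d ^ q)"
proof -
  have lin: "coeff ((monom c 1 + 1) ^ m) j = of_nat (m choose j) * c ^ j" for m j
  proof -
    have "coeff ((monom c 1 + 1) ^ m) j =
        (\<Sum>i\<le>m. if i = j then of_nat (m choose i) * c ^ i else 0)"
      by (simp add: binomial_ring monom_power coeff_sum of_nat_poly smult_monom if_distrib
          cong: if_cong)
    \<comment> \<open>For \<open>j > m\<close> no index matches, and the binomial coefficient is 0
      as well.\<close>
    also have "\<dots> = of_nat (m choose j) * c ^ j"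
      by (simp add: binomial_eq_0)
    finally show ?thesis .
  qed
  let ?t = "\<lambda>q. of_nat (n choose q) * of_nat ((n - q) choose (k - 2 * q)) * c ^ (k - 2 * q) * d ^ q"
  have "1 + monom c 1 + monom d 2 = monom d 2 + (monom c 1 + 1)"
    by (simp add: ac_simps)
  then have "(1 + monom c 1 + monom d 2) ^ n =
      (\<Sum>q\<le>n. of_nat (n choose q) * monom d 2 ^ q * (monom c 1 + 1) ^ (n - q))"
    by (simp only: binomial_ring)
  then have expand: "(1 + monom c 1 + monom d 2) ^ n =
      (\<Sum>q\<le>n. monom (of_nat (n choose q) * d ^ q) (2 * q) * (monom c 1 + 1) ^ (n - q))"
    by (simp add: monom_power of_nat_poly smult_monom)
  \<comment> \<open>A monomial of degree \<open>2 * q\<close> shifts coefficients: position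
    \<open>k\<close> reads position \<open>k - 2 * q\<close> of the linear power, or 0 if
    \<open>2 * q > k\<close>.\<close>
  have "coeff (\<Sum>q\<le>n. monom (of_nat (n choose q) * d ^ q) (2 * q) * (monom c 1 + 1) ^ (n - q)) k
      = (\<Sum>q\<le>n. if 2 * q \<le> k then ?t q else 0)"
    unfolding coeff_sum coeff_monom_mult lin by (intro sum.cong) (auto simp: ac_simps)
  also have "\<dots> = (\<Sum>q\<in>{..n} \<inter> {q. 2 * q \<le> k}. ?t q)"
    by (simp add: sum.If_cases)
  \<comment> \<open>The range may grow beyond \<open>n\<close>, since \<open>n choose q\<close>
    vanishes there.\<close>
  also have "\<dots> = (\<Sum>q = 0..k div 2. ?t q)"
    by (intro sum.mono_neutral_left) (auto simp: binomial_eq_0 simp flip: not_less)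
  finally show ?thesis
    unfolding expand .
qed

section \<open>Independent sets in a join\<close>

text \<open>A left and a right vertex are always adjacent, so an independent set stays on one side.
  The two alternatives overlap exactly in the empty set.\<close>

lemma independent_join_iff:
  fixes G :: "'a graph" and H :: "'b graph"
  shows "independent (G \<nabla> H) U \<longleftrightarrow>
     (\<exists>S. independent G S \<and> U = Inl ` S) \<or> (\<exists>T. independent H T \<and> U = Inr ` T)"
proof -
  \<comment> \<open>The other two kinds of join edges cannot equal a pair of left vertices, and
    injectivity of \<open>Inl\<close> recovers the edge of \<open>G\<close>.\<close>
  have inl: "{Inl u, Inl v} \<in> edges (G \<nabla> H) \<longleftrightarrow> {u, v} \<in> edges G" for u v
  proof -
    let ?i = "Inl :: 'a \<Rightarrow> 'a + 'b"
    have "{?i u, ?i v} = ?i ` e \<longleftrightarrow> {u, v} = e" for e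
      using inj_image_eq_iff[of ?i "{u, v}" e] by simp
    moreover have "{?i u, ?i v} \<noteq> Inr ` e" "{?i u, ?i v} \<noteq> {Inl x, Inr y}" for e x y
      by (auto simp: doubleton_eq_iff)
    ultimately show ?thesis
      by (auto simp: join_def)
  qed
  have inr: "{Inr u, Inr v} \<in> edges (G \<nabla> H) \<longleftrightarrow> {u, v} \<in> edges H" for u v
  proof -
    let ?i = "Inr :: 'b \<Rightarrow> 'a + 'b"
    have "{?i u, ?i v} = ?i ` e \<longleftrightarrow> {u, v} = e" for e
      using inj_image_eq_iff[of ?i "{u, v}" e] by simp
    moreover have "{?i u, ?i v} \<noteq> Inl ` e" "{?i u, ?i v} \<noteq> {Inl x, Inr y}" for e x y
      by (auto simp: doubleton_eq_iff)
    ultimately show ?thesis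
      by (auto simp: join_def)
  qed
  have vert: "verts (G \<nabla> H) = Inl ` verts G \<union> Inr ` verts H"
    by (simp add: join_def)
  show ?thesis
  proof
    assume U: "independent (G \<nabla> H) U"
    then have sub: "U \<subseteq> Inl ` verts G \<union> Inr ` verts H"
      by (simp add: independent_def vert)
    have "\<not> (Inl u \<in> U \<and> Inr v \<in> U)" for u v
    proof
      assume uv: "Inl u \<in> U \<and> Inr v \<in> U"
      then have "u \<in> verts G" "v \<in> verts H"
        using sub by auto
      then have "{Inl u, Inr v} \<in> edges (G \<nabla> H)"
        by (auto simp: join_def)
      then show False
        using U uv by (simp add: independent_def)
    qed
    then have "U \<subseteq> range Inl \<or> U \<subseteq> range Inr"
      using sub by blast
    then show "(\<exists>S. independent G S \<and> U = Inl ` S) \<or> (\<exists>T. independent H T \<and> U = Inr ` T)"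
    proof
      assume "U \<subseteq> range Inl"
      then obtain S where S: "U = Inl ` S"
        by (auto simp: subset_image_iff)
      have "independent G S"
        using U unfolding S by (auto simp: independent_def vert inl)
      with S show ?thesis
        by blast
    next
      assume "U \<subseteq> range Inr"
      then obtain S where S: "U = Inr ` S"
        by (auto simp: subset_image_iff)
      have "independent H S"
        using U unfolding S by (auto simp: independent_def vert inr)
      with S show ?thesis
        by blast
    qed
  next
    assume "(\<exists>S. independent G S \<and> U = Inl ` S) \<or> (\<exists>T. independent H T \<and> U = Inr ` T)"
    then show "independent (G \<nabla> H) U"
      by (auto simp: independent_def vert inl inr)
  qed
qed

text \<open>For \<open>k = 0\<close> the empty set would be counted on both sides;
  \<open>k \<ge> 1\<close> excludes this only overlap.\<close>

lemma num_indep_join: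
  fixes G :: "'a graph" and H :: "'b graph"
  assumes "finite (verts G)" "finite (verts H)" "k \<ge> 1"
  shows "num_indep k (G \<nabla> H) = num_indep k G + num_indep k H"
proof -
  let ?G = "{S. independent G S \<and> card S = k}" and ?H = "{S. independent H S \<and> card S = k}"
  let ?l = "(`) (Inl :: 'a \<Rightarrow> 'a + 'b)" and ?r = "(`) (Inr :: 'b \<Rightarrow> 'a + 'b)"
  have "{U. independent (G \<nabla> H) U \<and> card U = k} = ?l ` ?G \<union> ?r ` ?H"
    by (auto simp: independent_join_iff card_image)
  moreover have "?l ` ?G \<inter> ?r ` ?H = {}"
  proof -
    have "Inl ` S \<noteq> Inr ` T" if "card S = k" for S :: "'a set" and T :: "'b set"
      using that \<open>k \<ge> 1\<close> by (cases "S = {}") auto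
    then show ?thesis
      by blast
  qed
  moreover have "finite ?G" "finite ?H"
    using finite_independent[OF assms(1)] finite_independent[OF assms(2)]
    by (auto elim: rev_finite_subset)
  moreover have "card (?l ` ?G) = card ?G" "card (?r ` ?H) = card ?H"
    by (rule card_image, simp add: inj_on_def inj_image_eq_iff)+
  ultimately show ?thesis
    by (simp add: num_indep_def card_Un_disjoint)
qed

lemma num_indep_edgeless: "num_indep k (edgeless a) = a choose k"
  using n_subsets[of "{1..a}" k] by (simp add: num_indep_def independent_def edgeless_def)

section \<open>Counts for the copies of \<open>B b\<close> and for \<open>G_abn\<close>\<close>

theorem corollary3p4:
  fixes a b n :: nat
  assumes "a \<ge> 1" and "n \<ge> 1" and "b \<ge> 3"
  shows "(\<forall>k\<le>2 * n. num_indep k (copies n (B b)) =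
            (\<Sum>q = 0..k div 2. (n choose q) * ((n - q) choose (k - 2 * q))
                * (2 * b) ^ (k - 2 * q) * (b * (b - 1)) ^ q))
       \<and> (\<forall>k\<ge>1. num_indep k (G_abn a b n) = (a choose k) + num_indep k (copies n (B b)))
       \<and> num_indep 0 (G_abn a b n) = 1"
proof (intro conjI allI impI)
  have fin: "finite (verts (copies n (B b)))" "finite (verts (edgeless a))"
      "finite (verts (G_abn a b n))"
    using simple_graph_copies[OF simple_graph_B] simple_graph_edgeless simple_graph_G_abn
    by (simp_all add: simple_graph_def)
  show "num_indep k (copies n (B b)) =
      (\<Sum>q = 0..k div 2. (n choose q) * ((n - q) choose (k - 2 * q))
        * (2 * b) ^ (k - 2 * q) * (b * (b - 1)) ^ q)" for k
    \<comment> \<open>The count is read as coefficient \<open>k\<close> of the \<open>n\<close>-th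
      power of the quadratic; over \<open>nat\<close> the casts \<open>of_nat\<close> are the
      identity.\<close>
    unfolding coeff_indep_poly[OF fin(1), symmetric] indep_poly_copies[OF finite_verts_B]
      indep_poly_B coeff_quadratic_power by (simp only: of_nat_id)
  show "num_indep k (G_abn a b n) = (a choose k) + num_indep k (copies n (B b))" if "1 \<le> k" for k
    unfolding G_abn_def num_indep_join[OF fin(2,1) that] num_indep_edgeless ..
  show "num_indep 0 (G_abn a b n) = 1"
    by (rule num_indep_0[OF fin(3)])
qed

end
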